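(* For $x\in(-1/e,0)$ define $$\beta_0(x)=-1-\sqrt2\,\sqrt{1+ex}\quad\text{if } -1/e<x\le-1/4,$$ $$\beta_0(x)=\ln(-x)-\ln(-\ln(-x))\quad\text{if } -1/4<x<0,$$ $$\beta_{n+1}(x)=\frac{\beta_n(x)}{1+\beta_n(x)}\left(1+\ln\left(\frac{x}{\beta_n(x)}\right)\right)\quad(n\in\mathbb{N}).$$ Then for every $-1/e<x<0$ and every integer $n\ge1$, $$0<\mathrm{W}_{-1}(x)-\beta_n(x)<\left(\frac12\right)^{2^n}.$$ In particular, for $-1/4<x<0$ and every integer $n\ge 1$, the sharper estimate $$\mathrm{W}_{-1}(x)-\beta_n(x)<\left(\frac12\right)^{2^n}\left(\frac{1}{\left|\ln(-x)-\ln(-\ln(-x))\right|\cdot\left|1+\ln(-x)-\ln(-\ln(-x))\right|}\right)^{-1+2^n}$$ also holds.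
   Context: $\mathbb{N}=\{0,1,2,\ldots\}$. $\mathrm{W}_{-1}:[-1/e,0)\to(-\infty,-1]$ is the second real branch of the Lambert function: $\mathrm{W}_{-1}(x)$ is the unique $w\le -1$ with $we^w=x$. *)

theory Defs
  imports Complex_Main
begin

text \<open>
  The real branch \<open>W\<^sub>-\<^sub>1\<close> of the Lambert function; only its values for
  \<open>- exp (-1) \<le> x < 0\<close> are meaningful, since outside that interval the description
  has no solution.
\<close>
definition Lambert_Wm1 :: "real \<Rightarrow> real" where
  "Lambert_Wm1 x = (THE w. w \<le> -1 \<and> w * exp w = x)"

text \<open>
  Defined for all real \<open>x\<close> by totality of HOL functions; the intended domain is
  \<open>-1 / exp 1 < x < 0\<close>.
\<close>
primrec \<beta> :: "nat \<Rightarrow> real \<Rightarrow> real" where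
  "\<beta> 0 x = (if x \<le> -1/4 then -1 - sqrt 2 * sqrt (1 + exp 1 * x)
            else ln (-x) - ln (- ln (-x)))"
| "\<beta> (Suc n) x = \<beta> n x / (1 + \<beta> n x) * (1 + ln (x / \<beta> n x))"

end

theory Submission
  imports Defs
begin

declare \<beta>.simps [simp del]

text \<open>
  Put \<open>w = W\<^sub>-\<^sub>1(x)\<close> and \<open>t = w / \<beta>\<^sub>n\<close>. The recursion is Newton's method
  and gives \<open>w - \<beta>\<^sub>n\<^sub>+\<^sub>1 = \<beta>\<^sub>n / (1 + \<beta>\<^sub>n) \<cdot> (t - 1 - ln t)\<close>, which is positive when
  \<open>t \<noteq> 1\<close>. The starting value satisfies \<open>w < \<beta>\<^sub>0 < -1\<close>, and all later iterates lie below \<open>w\<close>.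
  Quadratic bounds on \<open>t - 1 - ln t\<close> then give
  \<open>\<bar>w - \<beta>\<^sub>n\<^sub>+\<^sub>1\<bar> < \<bar>w - \<beta>\<^sub>n\<bar>\<^sup>2 / D\<close> with \<open>D = 2\<beta>\<^sub>0(1 + \<beta>\<^sub>0)\<close>, hence
  \<open>w - \<beta>\<^sub>n < D \<cdot> ((\<beta>\<^sub>0 - w) / D) ^ 2\<^sup>n\<close> for \<open>n \<ge> 1\<close>. On the left interval
  \<open>\<beta>\<^sub>0 - w \<le> D / 4\<close> and \<open>D \<le> 4\<close>; on the right one \<open>\<beta>\<^sub>0 - w \<le> 2 / 3\<close> and \<open>D > 2\<close>.
\<close>

section \<open>Quadratic bounds on the logarithm\<close>

lemma ln_gt_quadratic:
  fixes t :: real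
  assumes "1 < t"
  shows "(t - 1) - (t - 1)\<^sup>2 / 2 < ln t"
proof -
  let ?f = "\<lambda>t::real. ln t - (t - 1) + (t - 1)\<^sup>2 / 2"
  have "?f 1 < ?f t"
  proof (rule DERIV_pos_imp_increasing_open[OF assms])
    fix s :: real assume s: "1 < s" "s < t"
    have "(?f has_real_derivative (1 / s - 1 + (s - 1))) (at s)"
      using s by (auto intro!: derivative_eq_intros simp: field_simps)
    moreover have "1 / s - 1 + (s - 1) = (s - 1)\<^sup>2 / s"
      using s by (simp add: field_simps power2_eq_square)
    moreover have "(s - 1)\<^sup>2 / s > 0" using s by simp
    ultimately show "\<exists>y. (?f has_real_derivative y) (at s) \<and> 0 < y" by metis
  qed (auto intro!: continuous_intros)
  then show ?thesis by simp
qed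

text \<open>The difference of the two sides has derivative
  \<open>(s - 1)\<^sup>2 / (2 * s\<^sup>2)\<close>. Applied to \<open>b / w\<close>, the right side
  combines with the linear terms of the Newton error into an exact square.\<close>

lemma ln_less_half_diff_inverse:
  fixes y :: real
  assumes "1 < y"
  shows "ln y < (y - 1 / y) / 2"
proof -
  let ?f = "\<lambda>y::real. (y - 1 / y) / 2 - ln y"
  have "?f 1 < ?f y"
  proof (rule DERIV_pos_imp_increasing_open[OF assms])
    fix s :: real assume s: "1 < s" "s < y"
    have "(?f has_real_derivative ((1 + 1 / s\<^sup>2) / 2 - 1 / s)) (at s)"
      using s by (auto intro!: derivative_eq_intros simp: power2_eq_square)
    moreover have "(1 + 1 / s\<^sup>2) / 2 - 1 / s = (s - 1)\<^sup>2 / (2 * s\<^sup>2)"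
      using s by (simp add: field_simps power2_eq_square)
    moreover have "(s - 1)\<^sup>2 / (2 * s\<^sup>2) > 0" using s by simp
    ultimately show "\<exists>y. (?f has_real_derivative y) (at s) \<and> 0 < y" by metis
  qed (auto intro!: continuous_intros)
  then show ?thesis by simp
qed

section \<open>Existence, uniqueness and range of the Lambert branch\<close>

lemma mult_exp_strict_antimono:
  fixes v w :: real
  assumes "v < w" "w \<le> -1"
  shows "w * exp w < v * exp v"
proof (rule DERIV_neg_imp_decreasing_open[OF assms(1)])
  fix s assume s: "v < s" "s < w"
  have "((\<lambda>s. s * exp s) has_real_derivative (1 + s) * exp s) (at s)"
    by (auto intro!: derivative_eq_intros simp: algebra_simps)
  moreover have "(1 + s) * exp s < 0"
    using s assms by (simp add: mult_neg_pos)
  ultimately show "\<exists>y. ((\<lambda>s. s * exp s) has_real_derivative y) (at s) \<and> y < 0" by blast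
qed (auto intro!: continuous_intros)

lemma Lambert_Wm1_ex1:
  fixes x :: real
  assumes "-1 / exp 1 < x" "x < 0"
  shows "\<exists>!w. w \<le> -1 \<and> w * exp w = x"
proof (rule ex_ex1I)
  \<comment> \<open>\<open>-u\<close> serves as left endpoint for the intermediate value theorem:
    \<open>u\<^sup>2 / 2 \<le> exp u\<close> gives \<open>u * exp (-u) \<le> 2 / u\<close>, and
    \<open>u\<close> is chosen to make \<open>2 / u\<close> equal to \<open>-x\<close>.\<close>
  define u where "u = 2 / (- x)"
  have "1 / exp 1 \<le> (1::real)" by simp
  moreover have "-x < 1 / exp 1" using assms by simp
  ultimately have "-x < 1" by linarith
  then have u: "u > 1" using assms unfolding u_def by (simp add: field_simps)
  have "u\<^sup>2 / 2 \<le> exp u"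
    using exp_lower_Taylor_quadratic[of u] u by simp
  then have "u * exp (-u) \<le> 2 / u"
    using u by (simp add: exp_minus field_simps power2_eq_square)
  also have "2 / u = -x" using assms by (simp add: u_def)
  finally have lo: "x \<le> (-u) * exp (-u)" by simp
  have hi: "(-1) * exp (-1) \<le> x"
    using assms by (simp add: exp_minus field_simps)
  have "\<exists>w\<ge>-u. w \<le> -1 \<and> w * exp w = x"
    by (rule IVT2') (use lo hi u in \<open>auto intro!: continuous_intros\<close>)
  then show "\<exists>w. w \<le> -1 \<and> w * exp w = x" by blast
next
  fix v w assume "v \<le> -1 \<and> v * exp v = x" "w \<le> -1 \<and> w * exp w = x"
  then show "v = w"
    using mult_exp_strict_antimono[of v w] mult_exp_strict_antimono[of w v]
    by (cases v w rule: linorder_cases) auto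
qed

lemma Lambert_Wm1_props:
  assumes "-1 / exp 1 < x" "x < 0"
  shows "Lambert_Wm1 x < -1" and "Lambert_Wm1 x * exp (Lambert_Wm1 x) = x"
proof -
  have *: "Lambert_Wm1 x \<le> -1 \<and> Lambert_Wm1 x * exp (Lambert_Wm1 x) = x"
    unfolding Lambert_Wm1_def by (rule theI'[OF Lambert_Wm1_ex1[OF assms]])
  have "Lambert_Wm1 x \<noteq> -1"
  proof
    assume "Lambert_Wm1 x = -1"
    with * have "- exp (-1) = x" by simp
    with assms show False by (simp add: exp_minus field_simps)
  qed
  with * show "Lambert_Wm1 x < -1" and "Lambert_Wm1 x * exp (Lambert_Wm1 x) = x" by auto
qed

section \<open>Error of the Newton iteration\<close>

lemma newton_error:
  fixes b w :: real
  assumes "b < -1" "w < -1"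
  shows "w - b / (1 + b) * (1 + ln (w * exp w / b)) = b / (1 + b) * (w / b - 1 - ln (w / b))"
proof -
  \<comment> \<open>Since \<open>w / b\<close> is positive, the logarithm splits into
    \<open>ln (w / b) + w\<close>; the rest is rational algebra.\<close>
  have "ln (w * exp w / b) = ln (w / b * exp w)" by simp
  also have "\<dots> = ln (w / b) + w"
    using assms by (subst ln_mult_pos) (auto simp: divide_neg_neg)
  finally have "ln (w * exp w / b) = ln (w / b) + w" .
  moreover have "b \<noteq> 0" "1 + b \<noteq> 0" using assms by auto
  ultimately show ?thesis by (simp add: divide_simps) (simp add: algebra_simps)
qed

lemma newton_error_pos:
  fixes b w :: real
  assumes "b < -1" "w < -1" "b \<noteq> w"
  shows "0 < b / (1 + b) * (w / b - 1 - ln (w / b))"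
proof -
  have "w / b > 0" "w / b \<noteq> 1" using assms by (auto simp: divide_neg_neg)
  then have "ln (w / b) < w / b - 1"
    using ln_le_minus_one[of "w / b"] ln_eq_minus_one[of "w / b"] by force
  moreover have "b / (1 + b) > 0" using assms by (simp add: divide_neg_neg)
  ultimately show ?thesis by (intro mult_pos_pos) auto
qed

lemma newton_error_less_above:
  fixes b w :: real
  assumes "w < b" "b < -1"
  shows "b / (1 + b) * (w / b - 1 - ln (w / b)) < (b - w)\<^sup>2 / (2 * b * (1 + b))"
proof -
  have "w / b > 1" using assms by (simp add: field_simps)
  then have "w / b - 1 - ln (w / b) < (w / b - 1)\<^sup>2 / 2"
    using ln_gt_quadratic[of "w / b"] by linarith
  moreover have "b / (1 + b) > 0" using assms by (simp add: divide_neg_neg)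
  ultimately have "b / (1 + b) * (w / b - 1 - ln (w / b)) < b / (1 + b) * ((w / b - 1)\<^sup>2 / 2)"
    by (rule mult_strict_left_mono)
  also have "(w / b - 1)\<^sup>2 = (b - w)\<^sup>2 / b\<^sup>2"
    using assms by (simp add: field_simps power2_eq_square)
  also have "b / (1 + b) * ((b - w)\<^sup>2 / b\<^sup>2 / 2) = (b - w)\<^sup>2 / (2 * b * (1 + b))"
    using assms by (simp add: power2_eq_square)
  finally show ?thesis .
qed

text \<open>Now \<open>w / b < 1\<close>, where the quadratic bound used for \<open>w < b\<close>
  fails. Bounding \<open>ln (b / w)\<close> instead works, with \<open>w\<close> in place of
  \<open>b\<close> as a factor of the denominator.\<close>

lemma newton_error_less_below:
  fixes b w :: real
  assumes "b < w" "w < -1"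
  shows "b / (1 + b) * (w / b - 1 - ln (w / b)) < (w - b)\<^sup>2 / (2 * w * (1 + b))"
proof -
  have "b / w > 1" using assms by (simp add: field_simps)
  then have "ln (b / w) < (b / w - w / b) / 2"
    using ln_less_half_diff_inverse[of "b / w"] by simp
  moreover have "ln (w / b) = - ln (b / w)"
    using assms ln_inverse[of "b / w"] by (simp add: divide_neg_neg)
  ultimately have "w / b - 1 - ln (w / b) < (w / b + b / w) / 2 - 1" by simp
  also have "\<dots> = (w - b)\<^sup>2 / (2 * w * b)"
  proof -
    have "w \<noteq> 0" "b \<noteq> 0" using assms by auto
    then show ?thesis by (simp add: field_simps power2_eq_square)
  qed
  finally have "w / b - 1 - ln (w / b) < (w - b)\<^sup>2 / (2 * w * b)" .
  moreover have "b / (1 + b) > 0" using assms by (simp add: divide_neg_neg)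
  ultimately have "b / (1 + b) * (w / b - 1 - ln (w / b)) < b / (1 + b) * ((w - b)\<^sup>2 / (2 * w * b))"
    by (rule mult_strict_left_mono)
  also have "\<dots> = (w - b)\<^sup>2 / (2 * w * (1 + b))"
    using assms by simp
  finally show ?thesis .
qed

text \<open>The first step starts above \<open>w\<close>, every later one below it. With
  \<open>r = (b - w) / D\<close>, the bound reproduces itself because
  \<open>(D * r ^ k)\<^sup>2 / D = D * r ^ (2 * k)\<close>.\<close>

lemma beta_error_bound:
  fixes x :: real
  defines "w \<equiv> Lambert_Wm1 x" and "b \<equiv> \<beta> 0 x"
  defines "D \<equiv> 2 * b * (1 + b)"
  assumes x: "-1 / exp 1 < x" "x < 0" and wb: "w < b" and b: "b < -1"
  shows "\<beta> (Suc n) x < w \<and> w - \<beta> (Suc n) x < D * ((b - w) / D) ^ 2 ^ Suc n"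
proof (induction n)
  have w: "w < -1" "w * exp w = x" using Lambert_Wm1_props[OF x] by (auto simp: w_def)
  have D: "D > 0" using b by (simp add: D_def mult_neg_neg)
  {
    case 0
    have "w - \<beta> (Suc 0) x = b / (1 + b) * (w / b - 1 - ln (w / b))"
      using newton_error[OF b w(1)] w(2) by (simp add: b_def \<beta>.simps(2))
    then have "\<beta> (Suc 0) x < w" "w - \<beta> (Suc 0) x < (b - w)\<^sup>2 / D"
      using newton_error_pos[OF b w(1)] newton_error_less_above[OF wb b] wb
      unfolding D_def by auto
    then show ?case using D by (simp add: power2_eq_square)
  next
    case (Suc n)
    let ?c = "\<beta> (Suc n) x"
    have c: "?c < w" "?c < -1" using Suc w by auto
    have eq: "w - \<beta> (Suc (Suc n)) x = ?c / (1 + ?c) * (w / ?c - 1 - ln (w / ?c))"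
      using newton_error[OF c(2) w(1)] w(2) by (simp add: \<beta>.simps(2)[of "Suc n"])
    \<comment> \<open>As \<open>?c < w < b < -1\<close>, both factors of the new denominator exceed
      those of \<open>D\<close> in absolute value, so one \<open>D\<close> serves all steps.\<close>
    have "D \<le> 2 * w * (1 + ?c)"
    proof -
      have "(-b) * (-1 - b) \<le> (-w) * (-1 - ?c)"
        by (rule mult_mono) (use c wb b in auto)
      then show ?thesis by (simp add: D_def algebra_simps)
    qed
    then have "(w - ?c)\<^sup>2 / (2 * w * (1 + ?c)) \<le> (w - ?c)\<^sup>2 / D"
      using D by (intro divide_left_mono) auto
    with newton_error_less_below[OF c(1) w(1)] eq
    have "w - \<beta> (Suc (Suc n)) x < (w - ?c)\<^sup>2 / D" by linarith
    also have "\<dots> \<le> (D * ((b - w) / D) ^ 2 ^ Suc n)\<^sup>2 / D"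
      using Suc c D by (intro divide_right_mono power_mono) auto
    also have "\<dots> = D * (((b - w) / D) ^ 2 ^ Suc n)\<^sup>2"
      using D by (simp add: power_mult_distrib power2_eq_square del: power_Suc)
    also have "\<dots> = D * ((b - w) / D) ^ 2 ^ Suc (Suc n)"
      by (simp only: power_Suc2[of 2 "Suc n"] power_mult)
    finally show ?case
      using newton_error_pos[OF c(2) w(1)] c eq by auto
  }
qed

section \<open>Starting value near the branch point\<close>

lemma exp_ge_cubic:
  fixes q :: real
  assumes "0 \<le> q"
  shows "1 + q + q\<^sup>2 / 2 + q ^ 3 / 6 \<le> exp q"
proof -
  obtain t where "exp q = (\<Sum>m<4. q ^ m / fact m) + exp t / fact 4 * q ^ 4"
    using Maclaurin_exp_le[of q 4] by auto
  moreover have "exp t / fact 4 * q ^ 4 \<ge> 0" using assms by simp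
  moreover have "(\<Sum>m<4. q ^ m / fact m) = 1 + q + q\<^sup>2 / 2 + q ^ 3 / 6"
    by (simp add: eval_nat_numeral)
  ultimately show ?thesis by linarith
qed

text \<open>With \<open>w = -1 - q\<close>, the equation \<open>w * exp w = x\<close> reads
  \<open>(1 + q) * exp (-q) = 1 - p\<^sup>2 / 2\<close> for
  \<open>p\<^sup>2 = 2 * (1 + exp 1 * x)\<close>. The inequality therefore places \<open>w\<close>
  below the starting value \<open>-1 - p\<close>.\<close>

lemma one_plus_mult_exp_minus_gt:
  fixes p :: real
  assumes "0 < p"
  shows "1 - p\<^sup>2 / 2 < (1 + p) * exp (-p)"
proof -
  let ?f = "\<lambda>p::real. (1 + p) * exp (-p) - (1 - p\<^sup>2 / 2)"
  have "?f 0 < ?f p"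
  proof (rule DERIV_pos_imp_increasing_open[OF assms])
    fix s :: real assume s: "0 < s" "s < p"
    have "(?f has_real_derivative (s * (1 - exp (-s)))) (at s)"
      by (auto intro!: derivative_eq_intros simp: algebra_simps)
    moreover have "s * (1 - exp (-s)) > 0" using s by simp
    ultimately show "\<exists>y. (?f has_real_derivative y) (at s) \<and> 0 < y" by blast
  qed (auto intro!: continuous_intros)
  then show ?thesis by simp
qed

text \<open>This yields \<open>-1 - q \<le> w\<close>. The value of \<open>q\<close> makes
  \<open>q - p = (p + p\<^sup>2) / 2\<close> exactly a quarter of
  \<open>D = 2 * p * (1 + p)\<close>.\<close>

lemma one_plus_mult_exp_minus_le:
  fixes p :: real
  assumes "0 \<le> p" "p \<le> 1"
  defines "q \<equiv> 3 / 2 * p + p\<^sup>2 / 2"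
  shows "(1 + q) * exp (-q) \<le> 1 - p\<^sup>2 / 2"
proof -
  \<comment> \<open>Writing \<open>q = p * m\<close> lets \<open>p\<^sup>2\<close> be factored out
    when \<open>1 + q\<close> is compared with \<open>1 - p\<^sup>2 / 2\<close> times the cubic
    Taylor polynomial of \<open>exp q\<close>.\<close>
  define m where "m = 3 / 2 + p / 2"
  have q: "q = p * m" by (simp add: q_def m_def power2_eq_square algebra_simps)
  have m: "m \<ge> 0" using assms by (simp add: m_def)
  have p2: "p\<^sup>2 \<le> 1" using assms by (simp add: power_le_one)
  have "m\<^sup>2 / 2 + p * m ^ 3 / 6 - 1 - p * m
      = (2 - 3 * p + 3 * p\<^sup>2 + 3 * p ^ 3 + p ^ 4 / 3) / 16"
    by (simp add: m_def power2_eq_square power3_eq_cube power4_eq_xxxx field_simps)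
  also have "\<dots> \<ge> 0"
  proof -
    have "2 - 3 * p + 3 * p\<^sup>2 = 3 * (p - 1 / 2)\<^sup>2 + 5 / 4"
      by (simp add: power2_eq_square algebra_simps)
    then have "2 - 3 * p + 3 * p\<^sup>2 \<ge> 0"
      using zero_le_power2[of "p - 1 / 2"] by linarith
    then show ?thesis using assms by simp
  qed
  finally have 1: "1 + p * m \<le> m\<^sup>2 / 2 + p * m ^ 3 / 6" by simp
  have 2: "p\<^sup>2 * m\<^sup>2 \<le> m\<^sup>2" "p\<^sup>2 * (p * m ^ 3) \<le> p * m ^ 3"
    using p2 m assms by (auto intro!: mult_left_le_one_le)
  have "1 + p * m + p\<^sup>2 * m\<^sup>2 / 2 + p\<^sup>2 * (p * m ^ 3) / 6 \<le> m\<^sup>2 + p * m ^ 3 / 3"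
    using 1 2 by linarith
  then have "p\<^sup>2 * (1 + p * m + p\<^sup>2 * m\<^sup>2 / 2 + p\<^sup>2 * (p * m ^ 3) / 6) \<le> p\<^sup>2 * (m\<^sup>2 + p * m ^ 3 / 3)"
    by (rule mult_left_mono) simp
  then have "1 + q \<le> (1 - p\<^sup>2 / 2) * (1 + q + q\<^sup>2 / 2 + q ^ 3 / 6)"
    by (simp add: q power2_eq_square power3_eq_cube field_simps)
  also have "\<dots> \<le> (1 - p\<^sup>2 / 2) * exp q"
    using p2 assms by (intro mult_left_mono exp_ge_cubic) (auto simp: q_def)
  finally show ?thesis by (simp add: exp_minus field_simps)
qed

lemma beta_error_near_branch_point:
  assumes x: "-1 / exp 1 < x" "x \<le> -1/4" and n: "n \<ge> 1"
  shows "\<beta> n x < Lambert_Wm1 x \<and> Lambert_Wm1 x - \<beta> n x < (1/2) ^ 2 ^ n"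
proof -
  define w where "w = Lambert_Wm1 x"
  define p where "p = sqrt 2 * sqrt (1 + exp 1 * x)"
  define D where "D = 2 * (-1 - p) * (1 + (-1 - p))"
  have w: "w < -1" "w * exp w = x" using Lambert_Wm1_props[of x] x by (auto simp: w_def)
  have pos: "1 + exp 1 * x > 0" using x by (simp add: field_simps)
  then have p0: "p > 0" by (simp add: p_def)
  have p2: "p\<^sup>2 = 2 * (1 + exp 1 * x)"
    using pos by (simp add: p_def power_mult_distrib)
  \<comment> \<open>From \<open>exp 1 \<ge> 5/2\<close> and \<open>x \<le> -1/4\<close> one gets
    \<open>p\<^sup>2 \<le> 3/4\<close>.\<close>
  have "exp 1 * x \<le> exp 1 * (-1/4)" using x by (intro mult_left_mono) auto
  moreover have "exp 1 \<ge> (5/2 :: real)"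
    using exp_lower_Taylor_quadratic[of 1] by simp
  ultimately have "p\<^sup>2 \<le> 1\<^sup>2" using p2 by simp
  then have p1: "p \<le> 1" by (rule power2_le_imp_le) simp
  have ex: "exp 1 * x = - (1 - p\<^sup>2 / 2)" using p2 by argo
  have shift: "exp 1 * ((-1 - q) * exp (-1 - q)) = - ((1 + q) * exp (-q))" for q :: real
    by (simp add: exp_diff exp_minus field_simps)
  have lo: "w < -1 - p"
  proof (rule ccontr)
    assume "\<not> ?thesis"
    then have "w * exp w \<le> (-1 - p) * exp (-1 - p)"
      using mult_exp_strict_antimono[of "-1 - p" w] w(1) by (cases "w = -1 - p") auto
    then have "exp 1 * x \<le> exp 1 * ((-1 - p) * exp (-1 - p))"
      using w by simp
    then show False
      using shift[of p] ex one_plus_mult_exp_minus_gt[OF p0] by linarith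
  qed
  define q where "q = 3 / 2 * p + p\<^sup>2 / 2"
  have hi: "-1 - q \<le> w"
  proof (rule ccontr)
    assume "\<not> ?thesis"
    moreover have "q \<ge> 0" using p0 by (simp add: q_def)
    ultimately have "(-1 - q) * exp (-1 - q) < w * exp w"
      using mult_exp_strict_antimono[of w "-1 - q"] by simp
    then have "exp 1 * ((-1 - q) * exp (-1 - q)) < exp 1 * x"
      using w by simp
    then show False
      using shift[of q] ex one_plus_mult_exp_minus_le[of p] p0 p1 unfolding q_def by linarith
  qed
  have b: "\<beta> 0 x = -1 - p" using x by (simp add: p_def \<beta>.simps(1))
  have D: "D = 2 * p + 2 * p\<^sup>2" by (simp add: D_def power2_eq_square algebra_simps)
  then have D0: "D > 0" using p0 by (simp add: add_pos_pos)
  have D4: "D \<le> 4" using D p1 \<open>p\<^sup>2 \<le> 1\<^sup>2\<close> by simp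
  obtain k where k: "n = Suc k" using n by (cases n) auto
  have "(-1 - p - w) \<le> D / 4" using hi D by (simp add: q_def)
  then have r: "(-1 - p - w) / D \<le> 1/4" using D0 by (simp add: field_simps)
  have r0: "(-1 - p - w) / D \<ge> 0" using D0 lo by simp
  have main: "\<beta> n x < w \<and> w - \<beta> n x < D * ((-1 - p - w) / D) ^ 2 ^ n"
    using beta_error_bound[of x k] x lo p0 unfolding k w_def[symmetric] b D_def[symmetric] by simp
  have "D * ((-1 - p - w) / D) ^ 2 ^ n \<le> 4 * (1/4) ^ 2 ^ n"
    using r r0 D4 D0 by (intro mult_mono power_mono) auto
  also have "\<dots> = (1/2) ^ 2 ^ n * (4 * (1/2) ^ 2 ^ n)"
    by (simp flip: power_mult_distrib)
  also have "\<dots> \<le> (1/2) ^ 2 ^ n * 1"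
  proof (rule mult_left_mono)
    \<comment> \<open>Here \<open>n \<ge> 1\<close> enters: the exponent is at least 2, so the last
      factor absorbs the 4 coming from \<open>D \<le> 4\<close>.\<close>
    have "(1/2::real) ^ 2 ^ n \<le> (1/2) ^ 2"
      using n power_increasing[of 1 n "2::nat"] by (intro power_decreasing) auto
    then show "4 * (1/2::real) ^ 2 ^ n \<le> 1" by (simp add: power2_eq_square)
  qed simp
  finally show ?thesis using main by (simp add: w_def)
qed

section \<open>Starting value away from the branch point\<close>

lemma neg_quarter_gt_branch_point:
  fixes x :: real
  assumes "-1/4 < x"
  shows "-1 / exp 1 < x"
proof -
  have "exp 1 < (4::real)" using exp_le by simp
  then have "-1 / exp 1 < (-1/4 :: real)" by (simp add: field_simps)
  then show ?thesis using assms by linarith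
qed

lemma beta_0_away_from_branch_point:
  assumes x: "-1/4 < x" "x < 0"
  shows "1 < \<beta> 0 x * (1 + \<beta> 0 x)" "\<beta> 0 x < -1"
proof -
  define L where "L = - ln (-x)"
  have "ln (-x) \<le> ln (1/4)" using x by (subst ln_le_cancel_iff) auto
  then have L4: "L \<ge> ln 4" by (simp add: L_def ln_div)
  \<comment> \<open>Factors close to 1 keep the quadratic bound accurate enough: it gives about
    1.3599.\<close>
  have "ln (4::real) = ln ((5/4) ^ 6 * (128/125) ^ 2)" by (simp add: power_divide)
  also have "\<dots> = 6 * ln (5/4) + 2 * ln (128/125)"
    by (subst ln_mult_pos) (simp_all only: ln_realpow, simp_all)
  also have "\<dots> > 135/100"
    using ln_gt_quadratic[of "5/4"] ln_gt_quadratic[of "128/125"] by (simp add: power2_eq_square)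
  finally have L: "L > 135/100" using L4 by linarith
  then have "ln L \<ge> ln (135/100)" by (subst ln_le_cancel_iff) auto
  moreover have "ln (135/100 :: real) > 28/100"
    using ln_gt_quadratic[of "135/100"] by (simp add: power2_eq_square)
  ultimately have s: "L + ln L > 163/100" using L by linarith
  have b: "\<beta> 0 x = - (L + ln L)" using x by (simp add: L_def \<beta>.simps(1))
  show "\<beta> 0 x < -1" using s b by linarith
  have "(163/100) * (63/100) \<le> (L + ln L) * (L + ln L - 1)"
    by (rule mult_mono) (use s in auto)
  then show "1 < \<beta> 0 x * (1 + \<beta> 0 x)" unfolding b by (simp add: algebra_simps)
qed

text \<open>With \<open>u = -w\<close>, the starting error is \<open>ln (u / L)\<close> for
  \<open>L = u - ln u\<close>. From \<open>ln u \<le> u / exp 1 \<le> 2/5 * u\<close> follows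
  \<open>u / L \<le> 5/3\<close>, and \<open>ln y \<le> y - 1\<close> gives 2/3.\<close>

lemma Lambert_Wm1_beta_0_away_from_branch_point:
  assumes x: "-1/4 < x" "x < 0"
  shows "Lambert_Wm1 x < \<beta> 0 x" "\<beta> 0 x - Lambert_Wm1 x \<le> 2/3"
proof -
  define u where "u = - Lambert_Wm1 x"
  have u1: "u > 1" and ux: "u * exp (-u) = -x"
    using Lambert_Wm1_props[OF neg_quarter_gt_branch_point[OF x(1)] x(2)] by (auto simp: u_def)
  define L where "L = - ln (-x)"
  have L: "L = u - ln u"
    using u1 by (simp add: L_def ux[symmetric] ln_mult_pos)
  have "ln (u / exp 1) \<le> u / exp 1 - 1" using u1 by (intro ln_le_minus_one) auto
  then have "ln u \<le> u / exp 1" using u1 by (simp add: ln_div)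
  also have "\<dots> \<le> u / (5/2)"
    using exp_lower_Taylor_quadratic[of 1] u1 by (intro divide_left_mono) auto
  finally have lnu: "ln u \<le> 2/5 * u" by simp
  have L0: "L > 0" and "L < u" using lnu u1 L by auto
  then have "ln L < ln u" using u1 by simp
  have b: "\<beta> 0 x - Lambert_Wm1 x = ln u - ln L"
    using x L by (simp add: u_def \<beta>.simps(1) flip: L_def) (simp add: L_def)
  then show "Lambert_Wm1 x < \<beta> 0 x" using \<open>ln L < ln u\<close> by linarith
  have "ln u - ln L = ln (u / L)" using u1 L0 by (simp add: ln_div)
  also have "\<dots> \<le> u / L - 1" using u1 L0 by (intro ln_le_minus_one) auto
  also have "\<dots> \<le> 2/3" using L0 lnu L by (simp add: field_simps)
  finally show "\<beta> 0 x - Lambert_Wm1 x \<le> 2/3" using b by simp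
qed

lemma beta_error_away_from_branch_point:
  assumes x: "-1/4 < x" "x < 0" and n: "n \<ge> 1"
  defines "K \<equiv> 1 / (\<bar>\<beta> 0 x\<bar> * \<bar>1 + \<beta> 0 x\<bar>)"
  shows "\<beta> n x < Lambert_Wm1 x"
    and "Lambert_Wm1 x - \<beta> n x < (1/2) ^ 2 ^ n * K ^ (2 ^ n - 1)"
    and "(1/2) ^ 2 ^ n * K ^ (2 ^ n - 1) < (1/2) ^ 2 ^ n"
proof -
  define d where "d = \<beta> 0 x - Lambert_Wm1 x"
  define D where "D = 2 * \<beta> 0 x * (1 + \<beta> 0 x)"
  note b = beta_0_away_from_branch_point[OF x]
  note w = Lambert_Wm1_beta_0_away_from_branch_point[OF x]
  have D2: "D > 2" using b by (simp add: D_def)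
  have d: "0 \<le> d" "d \<le> 2/3" using w by (auto simp: d_def)
  have "\<bar>\<beta> 0 x\<bar> * \<bar>1 + \<beta> 0 x\<bar> = \<beta> 0 x * (1 + \<beta> 0 x)"
    unfolding abs_mult[symmetric] using b by linarith
  then have K: "K = 2 / D" by (simp add: K_def D_def)
  obtain k where k: "n = Suc k" using n by (cases n) auto
  have main: "\<beta> n x < Lambert_Wm1 x \<and> Lambert_Wm1 x - \<beta> n x < D * (d / D) ^ 2 ^ n"
    using beta_error_bound[OF neg_quarter_gt_branch_point[OF x(1)] x(2) w(1) b(2), of k]
    unfolding k d_def D_def .
  then show "\<beta> n x < Lambert_Wm1 x" by simp
  \<comment> \<open>Replaces the truncated subtraction \<open>2 ^ n - 1\<close> by \<open>N\<close>.
    Since \<open>K = 2 / D\<close>, the target equals \<open>1/2 * (1 / D ^ N)\<close>, so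
    \<open>d ^ Suc N \<le> 1/2\<close> suffices; already \<open>(2/3)\<^sup>2 = 4/9\<close> is small
    enough.\<close>
  obtain N where N: "2 ^ n = Suc N" by (cases "2 ^ n :: nat") auto
  have N1: "Suc N \<ge> 2" using n power_increasing[of 1 n "2::nat"] unfolding N[symmetric] by simp
  have "d ^ Suc N \<le> (2/3) ^ Suc N" using d by (intro power_mono)
  also have "\<dots> \<le> (2/3) ^ 2" using N1 by (intro power_decreasing) auto
  finally have dN: "d ^ Suc N \<le> 1/2" by (simp add: power2_eq_square)
  have "D * (d / D) ^ Suc N = d ^ Suc N * (1 / D ^ N)"
    using D2 by (simp add: power_divide)
  also have "\<dots> \<le> 1/2 * (1 / D ^ N)" using dN D2 by (intro mult_right_mono) auto
  also have "\<dots> = (1/2) ^ Suc N * K ^ N"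
    by (simp add: K power_divide)
  finally show "Lambert_Wm1 x - \<beta> n x < (1/2) ^ 2 ^ n * K ^ (2 ^ n - 1)"
    using main unfolding N by simp
  have "K ^ N < 1" using K D2 N1 by (intro power_Suc_less_one power_strict_mono[of K 1 N, simplified]) auto
  then show "(1/2) ^ 2 ^ n * K ^ (2 ^ n - 1) < (1/2) ^ 2 ^ n"
    unfolding N by simp
qed

text \<open>The last inequality makes precise that the second estimate is sharper. The natural
  subtraction in \<open>2 ^ n - 1\<close> never truncates.\<close>

theorem theorem4p23:
  shows "(\<forall>x n. -1 / exp 1 < x \<and> x < 0 \<and> n \<ge> 1 \<longrightarrow>
            0 < Lambert_Wm1 x - \<beta> n x \<and>
            Lambert_Wm1 x - \<beta> n x < (1/2) ^ (2 ^ n))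
       \<and> (\<forall>x n. -1/4 < x \<and> x < 0 \<and> n \<ge> 1 \<longrightarrow>
            Lambert_Wm1 x - \<beta> n x
              < (1/2) ^ (2 ^ n) *
                (1 / (\<bar>ln (-x) - ln (- ln (-x))\<bar> * \<bar>1 + ln (-x) - ln (- ln (-x))\<bar>)) ^ (2 ^ n - 1)
            \<and> (1/2) ^ (2 ^ n) *
                (1 / (\<bar>ln (-x) - ln (- ln (-x))\<bar> * \<bar>1 + ln (-x) - ln (- ln (-x))\<bar>)) ^ (2 ^ n - 1)
              < (1/2) ^ (2 ^ n))"
proof (intro conjI allI impI; elim conjE)
  fix x :: real and n :: nat
  assume x: "-1 / exp 1 < x" "x < 0" and n: "n \<ge> 1"
  have "\<beta> n x < Lambert_Wm1 x \<and> Lambert_Wm1 x - \<beta> n x < (1/2) ^ 2 ^ n"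
  proof (cases "x \<le> -1/4")
    case True
    then show ?thesis using beta_error_near_branch_point x n by blast
  next
    case False
    then have "-1/4 < x" by simp
    from beta_error_away_from_branch_point[OF this x(2) n] show ?thesis by linarith
  qed
  then show "0 < Lambert_Wm1 x - \<beta> n x" "Lambert_Wm1 x - \<beta> n x < (1/2) ^ 2 ^ n" by auto
next
  fix x :: real and n :: nat
  assume x: "-1/4 < x" "x < 0" and n: "n \<ge> 1"
  have b: "\<beta> 0 x = ln (-x) - ln (- ln (-x))" using x by (simp add: \<beta>.simps(1))
  note * = beta_error_away_from_branch_point(2,3)[OF x n, unfolded b add_diff_eq]
  show "Lambert_Wm1 x - \<beta> n x
      < (1/2) ^ (2 ^ n) *
        (1 / (\<bar>ln (-x) - ln (- ln (-x))\<bar> * \<bar>1 + ln (-x) - ln (- ln (-x))\<bar>)) ^ (2 ^ n - 1)"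
    by (rule *(1))
  show "(1/2) ^ (2 ^ n) *
      (1 / (\<bar>ln (-x) - ln (- ln (-x))\<bar> * \<bar>1 + ln (-x) - ln (- ln (-x))\<bar>)) ^ (2 ^ n - 1)
      < (1/2) ^ (2 ^ n)"
    by (rule *(2))
qed

end
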